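(* Let $F$ be a tract, $\Gamma$ an ordered abelian group, $E$ a finite totally ordered set and $1\le r\le|E|$. Let $P\colon\binom Er\to F[\Gamma]$ be a function (representing $M$), and for $\mathbf u\in\Gamma^E$ let $P^{\mathbf u}\colon\binom Er\to F$ be its initial function (representing $M^{\mathbf u}$). Then $P$ is the Plücker vector of a weak $F[\Gamma]$-matroid $M$ if and only if, for all $\mathbf u\in\Gamma^E$, $P^{\mathbf u}$ is the Plücker vector of a weak $F$-matroid $M^{\mathbf u}$.
   Context: Tracts. A tract $F=(F^\times,N_F)$ is a multiplicative abelian group $F^\times$ (identity $1$) together with a subset $N_F$ (the null set) of the group semiring $\mathbb N[F^\times]$ of finite formal sums such that: $0\in N_F$; $1\notin N_F$; there is a unique element $-1\in F^\times$ with $1+(-1)\in N_F$; and if $\sum a_i\in N_F$ then $\sum c a_i\in N_F$ for all $c\in F^\times$. We also write $F=F^\times\cup\{0\}$ with $0\cdot g=0$; zero terms of formal sums are dropped. Tropical extension. $\Gamma$ is a (totally) ordered abelian group, written additively; $\infty$ is larger than every element of $\Gamma$ and absorbing. $F[\Gamma]$ is the tract with group $F^\times\times\Gamma$, zero element $\infty$, and null set consisting of the zero sum and all finite sums $\sum_{i\in I}(a_i,\gamma_i)$ with $\sum_{i\in I_{\min}}a_i\in N_F$, where $I_{\min}=\{i\in I:\gamma_i\le\gamma_j\ \forall j\in I\}$. Put $\theta(a,\gamma)=a$, $\theta(\infty)=0$, $|(a,\gamma)|=\gamma$, $|\infty|=\infty$. Weak matroids. A weak Plücker vector of rank $r$ on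 $E$ over a tract $F$ is a function $P\colon\binom Er\to F$, not identically zero, whose support $\{B:P(B)\ne0\}$ is the set of bases of a matroid, such that for all $I\in\binom{E}{r-1}$, $J\in\binom E{r+1}$ with $|J\setminus I|=3$, $$\sum_{j\in J\setminus I}\operatorname{sign}(j;I,J)\,P(I+j)\,P(J-j)\in N_F,$$ where $\operatorname{sign}(j;I,J)=(-1)^\ell$, $\ell=\#\{j'\in J:j<j'\}+\#\{i\in I:j<i\}$. A weak $F$-matroid is an equivalence class of weak Plücker vectors under scaling by $F^\times$. Initial function. For $P\colon\binom Er\to F[\Gamma]$ and $\mathbf u\in\Gamma^E$, $P^{\mathbf u}(I)=\theta(P(I))$ if $|P(I)|-\sum_{i\in I}u_i\le|P(J)|-\sum_{j\in J}u_j$ for all $J\in\binom Er$, and $P^{\mathbf u}(I)=0$ otherwise. *)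

theory Defs
  imports
    "HOL-Algebra.Group"
    "HOL-Library.Multiset"
    "HOL-Library.Extended"
    "HOL-Library.Ramsey"
begin

section \<open>Tracts\<close>

text \<open>
  A finite formal sum of group elements, i.e. an element of the group semiring with coefficients in
  the natural numbers, is a multiset of group elements. The record extends the group record by the
  null set.
\<close>

record 'a tract = "'a monoid" +
  nullset :: "'a multiset set"

locale tract = comm_group F for F (structure) +
  assumes nullset_carrier: "S \<in> nullset F \<Longrightarrow> set_mset S \<subseteq> carrier F"
    and zero_null: "{#} \<in> nullset F"
    and one_not_null: "{#\<one>#} \<notin> nullset F"
    and ex1_neg_one: "\<exists>!e. e \<in> carrier F \<and> {#\<one>, e#} \<in> nullset F"
    and scale_null: "\<lbrakk>c \<in> carrier F; S \<in> nullset F\<rbrakk> \<Longrightarrow> image_mset (\<lambda>a. c \<otimes> a) S \<in> nullset F"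

definition neg_one :: "('a, 'b) tract_scheme \<Rightarrow> 'a" where
  "neg_one F = (THE e. e \<in> carrier F \<and> {#\<one>\<^bsub>F\<^esub>, e#} \<in> nullset F)"

text \<open>
  The zero of a tract is adjoined as \<^const>\<open>None\<close>; for a tropical extension this is the element
  written as infinity.
\<close>

definition tract_elems :: "('a, 'b) tract_scheme \<Rightarrow> 'a option set" where
  "tract_elems F = insert None (Some ` carrier F)"

fun tract_mult :: "('a, 'b) tract_scheme \<Rightarrow> 'a option \<Rightarrow> 'a option \<Rightarrow> 'a option" where
  "tract_mult F (Some a) (Some b) = Some (a \<otimes>\<^bsub>F\<^esub> b)"
| "tract_mult F None _ = None"
| "tract_mult F _ None = None"

text \<open>The formal sum of \<open>f i\<close> over \<open>i \<in> I\<close>, with the zero terms dropped (for finite \<open>I\<close>).\<close>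

definition formal_sum :: "('i \<Rightarrow> 'a option) \<Rightarrow> 'i set \<Rightarrow> 'a multiset" where
  "formal_sum f I = image_mset (\<lambda>i. the (f i)) (mset_set {i \<in> I. f i \<noteq> None})"


section \<open>Tropical extensions\<close>

definition min_part :: "('a \<times> 'g::linorder) multiset \<Rightarrow> 'a multiset" where
  "min_part S = image_mset fst {#x \<in># S. \<forall>y \<in># S. snd x \<le> snd y#}"

definition tropical_extension ::
    "('a, 'b) tract_scheme \<Rightarrow> ('a \<times> 'g::linordered_ab_group_add) tract" where
  "tropical_extension F =
     \<lparr> carrier = carrier F \<times> UNIV,
       monoid.mult = (\<lambda>(a, \<gamma>) (b, \<delta>). (a \<otimes>\<^bsub>F\<^esub> b, \<gamma> + \<delta>)),
       one = (\<one>\<^bsub>F\<^esub>, 0),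
       nullset = {S. set_mset S \<subseteq> carrier F \<times> UNIV \<and> (S = {#} \<or> min_part S \<in> nullset F)} \<rparr>"

definition angular :: "('a \<times> 'g) option \<Rightarrow> 'a option" where
  "angular x = map_option fst x"

text \<open>The absolute value, with values in the extended group; the value \<^const>\<open>Minf\<close> of the type
  does not occur.\<close>

definition trop_abs :: "('a \<times> 'g) option \<Rightarrow> 'g extended" where
  "trop_abs x = (case x of None \<Rightarrow> Pinf | Some (a, \<gamma>) \<Rightarrow> Fin \<gamma>)"


section \<open>Weak matroids over a tract\<close>

definition matroid_bases :: "'e set \<Rightarrow> 'e set set \<Rightarrow> bool" where
  "matroid_bases E \<B> \<longleftrightarrow> finite E \<and> \<B> \<noteq> {} \<and> \<B> \<subseteq> Pow E \<and>
     (\<forall>B \<in> \<B>. \<forall>B' \<in> \<B>. \<forall>x \<in> B - B'. \<exists>y \<in> B' - B. insert y (B - {x}) \<in> \<B>)"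

definition pluecker_support :: "'e set \<Rightarrow> nat \<Rightarrow> ('e set \<Rightarrow> 'a option) \<Rightarrow> 'e set set" where
  "pluecker_support E r P = {B \<in> [E]\<^bsup>r\<^esup>. P B \<noteq> None}"

definition pluecker_sign ::
    "('a, 'b) tract_scheme \<Rightarrow> 'e::linorder \<Rightarrow> 'e set \<Rightarrow> 'e set \<Rightarrow> 'a" where
  "pluecker_sign F j I J =
     neg_one F [^]\<^bsub>F\<^esub> (card {j' \<in> J. j < j'} + card {i \<in> I. j < i})"

text \<open>Functions on the \<open>r\<close>-subsets of \<open>E\<close> are taken to be extensional, so that equality of such
  functions is the HOL equality.\<close>

definition weak_pluecker_vectors ::
    "('a, 'b) tract_scheme \<Rightarrow> 'e::linorder set \<Rightarrow> nat \<Rightarrow> ('e set \<Rightarrow> 'a option) set" where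
  "weak_pluecker_vectors F E r =
     {P \<in> [E]\<^bsup>r\<^esup> \<rightarrow>\<^sub>E tract_elems F.
        (\<exists>B \<in> [E]\<^bsup>r\<^esup>. P B \<noteq> None) \<and>
        matroid_bases E (pluecker_support E r P) \<and>
        (\<forall>I \<in> [E]\<^bsup>(r - 1)\<^esup>. \<forall>J \<in> [E]\<^bsup>(r + 1)\<^esup>. card (J - I) = 3 \<longrightarrow>
           formal_sum
             (\<lambda>j. tract_mult F (Some (pluecker_sign F j I J))
                    (tract_mult F (P (insert j I)) (P (J - {j}))))
             (J - I) \<in> nullset F)}"

definition pluecker_scaling ::
    "('a, 'b) tract_scheme \<Rightarrow> 'e::linorder set \<Rightarrow> nat \<Rightarrow> ('e set \<Rightarrow> 'a option) rel" where
  "pluecker_scaling F E r =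
     {(P, Q). P \<in> weak_pluecker_vectors F E r \<and> Q \<in> weak_pluecker_vectors F E r \<and>
        (\<exists>c \<in> carrier F. Q = (\<lambda>B \<in> [E]\<^bsup>r\<^esup>. tract_mult F (Some c) (P B)))}"

definition weak_matroids ::
    "('a, 'b) tract_scheme \<Rightarrow> 'e::linorder set \<Rightarrow> nat \<Rightarrow> ('e set \<Rightarrow> 'a option) set set" where
  "weak_matroids F E r = weak_pluecker_vectors F E r // pluecker_scaling F E r"

definition initial_function ::
    "'e set \<Rightarrow> nat \<Rightarrow> ('e \<Rightarrow> 'g::linordered_ab_group_add) \<Rightarrow>
     ('e set \<Rightarrow> ('a \<times> 'g) option) \<Rightarrow> 'e set \<Rightarrow> 'a option" where
  "initial_function E r u P =
     (\<lambda>I \<in> [E]\<^bsup>r\<^esup>.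
        if \<forall>J \<in> [E]\<^bsup>r\<^esup>. trop_abs (P I) - Fin (\<Sum>i\<in>I. u i) \<le> trop_abs (P J) - Fin (\<Sum>j\<in>J. u j)
        then angular (P I) else None)"


section \<open>Well-formedness\<close>

lemma min_part_single: "min_part {#(a, \<gamma>)#} = {#a#}"
  by (simp add: min_part_def)

lemma min_part_scale:
  fixes \<gamma> :: "'g::linordered_ab_group_add"
  shows "min_part (image_mset (\<lambda>(b, \<delta>). (c \<otimes>\<^bsub>F\<^esub> b, \<gamma> + \<delta>)) S) =
         image_mset (\<lambda>b. c \<otimes>\<^bsub>F\<^esub> b) (min_part S)"
  by (simp add: min_part_def filter_mset_image_mset image_mset.compositionality
      comp_def case_prod_unfold)

lemma tract_tropical_extension:
  fixes F :: "('a, 'b) tract_scheme"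
  assumes "tract F"
  shows "tract (tropical_extension F :: ('a \<times> 'g::linordered_ab_group_add) tract)"
    (is "tract ?T")
proof -
  interpret tract F by fact
  have single: "{#a#} \<notin> nullset F" if "a \<in> carrier F" for a
  proof
    assume "{#a#} \<in> nullset F"
    then have "image_mset (\<lambda>x. inv\<^bsub>F\<^esub> a \<otimes>\<^bsub>F\<^esub> x) {#a#} \<in> nullset F"
      using that by (intro scale_null) auto
    then show False using that one_not_null by simp
  qed
  have grp: "comm_group ?T"
  proof (rule comm_groupI)
    fix x assume "x \<in> carrier ?T"
    then show "\<exists>y \<in> carrier ?T. y \<otimes>\<^bsub>?T\<^esub> x = \<one>\<^bsub>?T\<^esub>"
      by (intro bexI[of _ "(inv\<^bsub>F\<^esub> fst x, - snd x)"])
        (auto simp: tropical_extension_def)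
  qed (auto simp: tropical_extension_def m_ac ac_simps)
  have pair: "{#(\<one>\<^bsub>F\<^esub>, 0), (e, \<gamma>)#} \<in> nullset ?T \<longleftrightarrow> \<gamma> = 0 \<and> {#\<one>\<^bsub>F\<^esub>, e#} \<in> nullset F"
    if "e \<in> carrier F" for e and \<gamma> :: 'g
  proof -
    consider "\<gamma> = 0" | "\<gamma> < 0" | "0 < \<gamma>" by (metis linorder_neqE)
    then show ?thesis
      by cases (use that single[of e] one_not_null in
          \<open>auto simp: tropical_extension_def min_part_def\<close>)
  qed
  obtain e where e: "e \<in> carrier F" "{#\<one>\<^bsub>F\<^esub>, e#} \<in> nullset F"
    and e_unique: "\<And>e'. e' \<in> carrier F \<Longrightarrow> {#\<one>\<^bsub>F\<^esub>, e'#} \<in> nullset F \<Longrightarrow> e' = e"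
    using ex1_neg_one by blast
  have T_carrier: "x \<in> carrier ?T \<longleftrightarrow> fst x \<in> carrier F" for x
    by (cases x) (simp add: tropical_extension_def)
  have T_one: "\<one>\<^bsub>?T\<^esub> = (\<one>\<^bsub>F\<^esub>, 0)"
    by (simp add: tropical_extension_def)
  have ex1: "\<exists>!x. x \<in> carrier ?T \<and> {#\<one>\<^bsub>?T\<^esub>, x#} \<in> nullset ?T"
  proof (rule ex1I[of _ "(e, 0)"])
    show "(e, 0) \<in> carrier ?T \<and> {#\<one>\<^bsub>?T\<^esub>, (e, 0)#} \<in> nullset ?T"
      using e by (simp add: T_carrier T_one pair)
  next
    fix x assume "x \<in> carrier ?T \<and> {#\<one>\<^bsub>?T\<^esub>, x#} \<in> nullset ?T"
    then show "x = (e, 0)"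
      by (cases x) (auto simp: T_carrier T_one pair intro: e_unique)
  qed
  have scale: "image_mset (\<lambda>a. c \<otimes>\<^bsub>?T\<^esub> a) S \<in> nullset ?T"
    if "c \<in> carrier ?T" "S \<in> nullset ?T" for c S
  proof -
    obtain a \<gamma> where c: "c = (a, \<gamma>)" by (cases c)
    show ?thesis
      using that scale_null[of a "min_part S"]
      by (auto simp: c tropical_extension_def min_part_scale)
  qed
  show ?thesis
  proof (intro tract.intro tract_axioms.intro grp ex1 scale)
    show "\<And>S. S \<in> nullset ?T \<Longrightarrow> set_mset S \<subseteq> carrier ?T" "{#} \<in> nullset ?T"
      "{#\<one>\<^bsub>?T\<^esub>#} \<notin> nullset ?T"
      using one_not_null by (auto simp: tropical_extension_def min_part_single)
  qed
qed

lemma equiv_pluecker_scaling: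
  fixes F :: "('a, 'b) tract_scheme" and E :: "'e::linorder set"
  assumes "tract F"
  shows "equiv (weak_pluecker_vectors F E r) (pluecker_scaling F E r)"
proof -
  interpret tract F by fact
  have ext: "P = (\<lambda>B \<in> [E]\<^bsup>r\<^esup>. P B)" and elem: "B \<in> [E]\<^bsup>r\<^esup> \<Longrightarrow> P B \<in> tract_elems F"
    if "P \<in> weak_pluecker_vectors F E r" for P B
    using that by (auto simp: weak_pluecker_vectors_def PiE_restrict)
  have one: "tract_mult F (Some \<one>\<^bsub>F\<^esub>) x = x" if "x \<in> tract_elems F" for x
    using that by (auto simp: tract_elems_def)
  have assoc: "tract_mult F (Some c) (tract_mult F (Some d) x) = tract_mult F (Some (c \<otimes>\<^bsub>F\<^esub> d)) x"
    if "x \<in> tract_elems F" "c \<in> carrier F" "d \<in> carrier F" for c d x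
    using that by (auto simp: tract_elems_def m_assoc)
  show ?thesis
  proof (rule equivI)
    show "pluecker_scaling F E r \<subseteq> weak_pluecker_vectors F E r \<times> weak_pluecker_vectors F E r"
      by (auto simp: pluecker_scaling_def)
    show "refl_on (weak_pluecker_vectors F E r) (pluecker_scaling F E r)"
    proof (rule refl_onI)
      fix P assume P: "P \<in> weak_pluecker_vectors F E r"
      have "P = (\<lambda>B \<in> [E]\<^bsup>r\<^esup>. tract_mult F (Some \<one>\<^bsub>F\<^esub>) (P B))"
        by (subst ext[OF P]) (auto simp: one elem[OF P] intro!: restrict_ext)
      with P show "(P, P) \<in> pluecker_scaling F E r"
        by (auto simp: pluecker_scaling_def)
    qed
    show "sym (pluecker_scaling F E r)"
    proof (rule symI)
      fix P Q assume "(P, Q) \<in> pluecker_scaling F E r"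
      then obtain c where P: "P \<in> weak_pluecker_vectors F E r"
        and Q: "Q \<in> weak_pluecker_vectors F E r" and c: "c \<in> carrier F"
        and eq: "Q = (\<lambda>B \<in> [E]\<^bsup>r\<^esup>. tract_mult F (Some c) (P B))"
        by (auto simp: pluecker_scaling_def)
      have "P = (\<lambda>B \<in> [E]\<^bsup>r\<^esup>. tract_mult F (Some (inv\<^bsub>F\<^esub> c)) (Q B))"
        by (subst ext[OF P]) (use c in \<open>auto simp: eq assoc one elem[OF P] intro!: restrict_ext\<close>)
      with P Q c show "(Q, P) \<in> pluecker_scaling F E r"
        unfolding pluecker_scaling_def by blast
    qed
    show "trans (pluecker_scaling F E r)"
    proof (rule transI)
      fix P Q R assume "(P, Q) \<in> pluecker_scaling F E r" "(Q, R) \<in> pluecker_scaling F E r"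
      then obtain c d where P: "P \<in> weak_pluecker_vectors F E r"
        and R: "R \<in> weak_pluecker_vectors F E r" and c: "c \<in> carrier F" and d: "d \<in> carrier F"
        and eq: "Q = (\<lambda>B \<in> [E]\<^bsup>r\<^esup>. tract_mult F (Some c) (P B))"
          "R = (\<lambda>B \<in> [E]\<^bsup>r\<^esup>. tract_mult F (Some d) (Q B))"
        unfolding pluecker_scaling_def by blast
      have "R = (\<lambda>B \<in> [E]\<^bsup>r\<^esup>. tract_mult F (Some (d \<otimes>\<^bsub>F\<^esub> c)) (P B))"
        unfolding eq using c d by (auto simp: assoc elem[OF P] intro!: restrict_ext)
      with P R c d show "(P, R) \<in> pluecker_scaling F E r"
        unfolding pluecker_scaling_def by blast
    qed
  qed
qed

end

theory Submission
  imports Defs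
begin

text \<open>
  A tropical Pluecker vector is a support \<open>\<B>\<close> with a valuation \<open>\<omega>\<close>, and the support of \<open>P\<^sup>u\<close> is the set
  of minimizers of \<open>\<omega> - u\<close> on \<open>\<B>\<close>. If some term of a three-term relation has both its factors among
  these minimizers, then the relation of \<open>P\<^sup>u\<close> is the minimal part of the relation of \<open>P\<close>; otherwise
  the relation of \<open>P\<^sup>u\<close> is empty.

  For the forward direction, the three-term relations give valuated exchange for bases at distance
  two, and Murota's local-to-global argument extends it to all pairs of bases of the matroid \<open>\<B>\<close>, so
  that the minimizers form a matroid. For the converse, each three-term relation and each instance
  of basis exchange is detected by one well-chosen \<open>u\<close>, large weights having reduced the problem to a
  small interval of subsets. Only sums and differences enter the choice of \<open>u\<close>, hence no
  divisibility of the ordered group is needed.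
\<close>

section \<open>Valuated exchange\<close>

text \<open>Induction on the distance: while \<open>C\<close> has another element \<open>w\<close>
  outside \<open>D\<close>, ordinary exchange trades \<open>w\<close> for an element of
  \<open>D\<close>, which moves \<open>C\<close> closer to \<open>D\<close> and keeps
  \<open>x\<close>. At distance one the set \<open>D - {y}\<close> with \<open>x\<close> added is
  \<open>C\<close> itself.\<close>

lemma matroid_dual_exchange:
  assumes "matroid_bases E \<B>" "\<B> \<subseteq> [E]\<^bsup>r\<^esup>" "C \<in> \<B>" "D \<in> \<B>" "x \<in> C - D"
  shows "\<exists>y \<in> D - C. insert x (D - {y}) \<in> \<B>"
  using assms(3,5)
proof (induction "card (C - D)" arbitrary: C rule: less_induct)
  case less
  have fin: "finite C" "finite D" and card: "card C = card D"
    using assms(2,4) less.prems(1) by (auto simp: nsets_def)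
  show ?case
  proof (cases "C - D = {x}")
    case True
    then have "card (D - C) = 1"
      by (metis card card_le_sym_Diff card_1_singleton_iff fin le_antisym One_nat_def card.empty card_insert_disjoint empty_iff finite.emptyI nle_le)
    then obtain y where y: "D - C = {y}" by (auto simp: card_1_singleton_iff)
    then have "insert x (D - {y}) = C" using True by blast
    with y less.prems show ?thesis by auto
  next
    case False
    then obtain w where w: "w \<in> C - D" "w \<noteq> x" using less.prems by blast
    then obtain y where y: "y \<in> D - C" "insert y (C - {w}) \<in> \<B>"
      using assms(1,4) less.prems unfolding matroid_bases_def by blast
    have "insert y (C - {w}) - D = C - D - {w}" using y by blast
    then have "card (insert y (C - {w}) - D) < card (C - D)"
      using w fin by (metis card_Diff1_less finite_Diff)
    from less.hyps[OF this y(2)] w less.prems obtain z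
      where "z \<in> D - insert y (C - {w})" "insert x (D - {z}) \<in> \<B>" by blast
    then show ?thesis using w by blast
  qed
qed

text \<open>The exchange axiom of valuated matroids in the minimum convention, at one instance. Sets
  outside the support count as having infinite value, hence the two membership conditions.\<close>

definition exchange_pair ::
    "'e set set \<Rightarrow> ('e set \<Rightarrow> 'g::linordered_ab_group_add) \<Rightarrow> 'e set \<Rightarrow> 'e set \<Rightarrow> 'e \<Rightarrow> bool" where
  "exchange_pair \<B> \<omega> C D x \<longleftrightarrow>
     (\<exists>y \<in> D - C. insert y (C - {x}) \<in> \<B> \<and> insert x (D - {y}) \<in> \<B> \<and>
        \<omega> (insert y (C - {x})) + \<omega> (insert x (D - {y})) \<le> \<omega> C + \<omega> D)"

text \<open>The exchanged sets contain the same elements as \<open>C\<close> and \<open>D\<close>,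
  counted with multiplicity, so \<open>p\<close> contributes equally to both sides and
  cancels.\<close>

lemma exchange_pair_tilt:
  fixes p :: "'e \<Rightarrow> 'g::linordered_ab_group_add"
  assumes "finite C" "finite D" "x \<in> C - D"
  shows "exchange_pair \<B> (\<lambda>B. \<omega> B + sum p B) C D x \<longleftrightarrow> exchange_pair \<B> \<omega> C D x"
proof -
  have "\<omega> (insert y (C - {x})) + sum p (insert y (C - {x})) +
      (\<omega> (insert x (D - {y})) + sum p (insert x (D - {y}))) \<le> \<omega> C + sum p C + (\<omega> D + sum p D) \<longleftrightarrow>
    \<omega> (insert y (C - {x})) + \<omega> (insert x (D - {y})) \<le> \<omega> C + \<omega> D"
    if "y \<in> D - C" for y
  proof -
    have eq: "sum p (insert y (C - {x})) = sum p C - p x + p y"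
      "sum p (insert x (D - {y})) = sum p D - p y + p x"
      using assms that by (simp_all add: sum_diff1)
    show ?thesis unfolding eq by (simp add: algebra_simps)
  qed
  then show ?thesis by (auto simp: exchange_pair_def intro!: bex_cong)
qed

text \<open>Induction on the distance with \<open>C\<close> fixed. If exchange fails at
  \<open>D\<close>, move \<open>D\<close> to a cheapest neighbour \<open>D1\<close> containing a
  second element \<open>u\<close> of \<open>C - D\<close>, exchange between \<open>C\<close> and
  \<open>D1\<close> to get \<open>D2\<close>, and apply the local hypothesis to \<open>D2\<close>
  and \<open>D\<close>. After a suitable tilt the inequalities contradict each other.\<close>

lemma local_exchange_imp_exchange:
  fixes \<omega> :: "'e set \<Rightarrow> 'g::linordered_ab_group_add"
  assumes mat: "matroid_bases E \<B>" and unif: "\<B> \<subseteq> [E]\<^bsup>r\<^esup>" and pos: "0 < (\<epsilon>::'g)"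
    and loc: "\<And>C D x. \<lbrakk>C \<in> \<B>; D \<in> \<B>; card (C - D) = 2; x \<in> C - D\<rbrakk> \<Longrightarrow> exchange_pair \<B> \<omega> C D x"
    and "C \<in> \<B>" "D \<in> \<B>" "x \<in> C - D"
  shows "exchange_pair \<B> \<omega> C D x"
  using \<open>D \<in> \<B>\<close> \<open>x \<in> C - D\<close>
proof (induction "card (C - D)" arbitrary: D rule: less_induct)
  case less
  have fin: "finite B" if "B \<in> \<B>" for B using unif that by (auto simp: nsets_def)
  have finC: "finite C" and finD: "finite D" using fin \<open>C \<in> \<B>\<close> less.prems by auto
  have card: "card C = card D" using unif \<open>C \<in> \<B>\<close> less.prems by (auto simp: nsets_def)
  show ?case
  proof (cases "C - D = {x}")
    \<comment> \<open>At distance one the exchange merely interchanges \<open>C\<close> and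
      \<open>D\<close>, so both sides of the inequality agree.\<close>
    case True
    obtain y where y: "y \<in> D - C" "insert x (D - {y}) \<in> \<B>"
      using matroid_dual_exchange[OF mat unif \<open>C \<in> \<B>\<close> less.prems] by blast
    have "insert x (D - {y}) = C"
    proof (rule sym, rule card_subset_eq)
      show "C \<subseteq> insert x (D - {y})" using True y by blast
      show "card C = card (insert x (D - {y}))"
        using unif \<open>C \<in> \<B>\<close> y by (auto simp: nsets_def)
    qed (use finD in auto)
    moreover from this have "insert y (C - {x}) = D" using y less.prems by blast
    ultimately show ?thesis
      unfolding exchange_pair_def using \<open>C \<in> \<B>\<close> less.prems(1)
      by (intro bexI[OF _ y(1)]) (simp add: add.commute)
  next
    case False
    then obtain u where u: "u \<in> C - D" "u \<noteq> x" using less.prems by blast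
    show ?thesis
    proof (rule ccontr)
      assume viol: "\<not> exchange_pair \<B> \<omega> C D x"
      txt \<open>Tilting by \<open>p\<close> makes every exchange of \<open>x\<close> out of \<open>C\<close> neutral and every exchange of \<open>x\<close> into
        \<open>D\<close> strictly costly; \<open>\<epsilon>\<close> serves the \<open>v\<close> for which only the latter exchange is a basis.\<close>
      define p where "p v = (if v \<in> D - C then
          (if insert v (C - {x}) \<in> \<B> then \<omega> C - \<omega> (insert v (C - {x}))
           else \<omega> (insert x (D - {v})) - \<omega> D - \<epsilon>) else 0)" for v
      define f where "f = (\<lambda>B. \<omega> B + sum p B)"
      have px: "p x = 0" using less.prems by (simp add: p_def)
      have f_C: "f (insert v (C - {x})) = \<omega> (insert v (C - {x})) + (sum p C + p v)"
        and f_D: "f (insert x (D - {v})) = \<omega> (insert x (D - {v})) + (sum p D - p v)" if "v \<in> D - C" for v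
        using that px less.prems finC finD by (simp_all add: f_def sum_diff1)
      have tight: "f (insert v (C - {x})) = f C" if v: "v \<in> D - C" "insert v (C - {x}) \<in> \<B>" for v
      proof -
        have "p v = \<omega> C - \<omega> (insert v (C - {x}))" using v by (simp add: p_def)
        then show ?thesis using f_C[OF v(1)] by (simp add: f_def)
      qed
      have large: "f D < f (insert x (D - {v}))" if v: "v \<in> D - C" "insert x (D - {v}) \<in> \<B>" for v
      proof (cases "insert v (C - {x}) \<in> \<B>")
        case True
        then have pv: "p v = \<omega> C - \<omega> (insert v (C - {x}))" using v by (simp add: p_def)
        have "\<omega> C + \<omega> D < \<omega> (insert v (C - {x})) + \<omega> (insert x (D - {v}))"
          using True viol v by (auto simp: exchange_pair_def not_le)
        then show ?thesis unfolding f_D[OF v(1)] pv by (simp add: f_def algebra_simps)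
      next
        case False
        then have pv: "p v = \<omega> (insert x (D - {v})) - \<omega> D - \<epsilon>" using v by (simp add: p_def)
        show ?thesis unfolding f_D[OF v(1)] pv using pos by (simp add: f_def algebra_simps)
      qed
      \<comment> \<open>Among all bases obtained from \<open>D\<close> by bringing in
        \<open>u\<close>, the one with least \<open>f\<close> is taken; dual exchange ensures that
        there is one.\<close>
      define V where "V = {v \<in> D - C. insert u (D - {v}) \<in> \<B>}"
      have "finite V" "V \<noteq> {}"
        using finD matroid_dual_exchange[OF mat unif \<open>C \<in> \<B>\<close> less.prems(1) u(1)] by (auto simp: V_def)
      then obtain v where v: "v \<in> V"
        and vmin: "\<And>v'. v' \<in> V \<Longrightarrow> f (insert u (D - {v})) \<le> f (insert u (D - {v'}))"
        using arg_min_if_finite[of V "\<lambda>v. f (insert u (D - {v}))"] by (meson not_le)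
      define D1 where "D1 = insert u (D - {v})"
      have D1: "D1 \<in> \<B>" using v by (simp add: V_def D1_def)
      have "C - D1 = C - D - {u}" using v by (auto simp: V_def D1_def)
      then have "card (C - D1) < card (C - D)" using u finC by (metis card_Diff1_less finite_Diff)
      moreover have xD1: "x \<in> C - D1" using u less.prems by (auto simp: D1_def)
      ultimately have "exchange_pair \<B> \<omega> C D1 x" using less.hyps D1 by blast
      then have "exchange_pair \<B> f C D1 x"
        unfolding f_def by (rule exchange_pair_tilt[THEN iffD2, OF finC fin[OF D1] xD1])
      then obtain y where y: "y \<in> D1 - C" "insert y (C - {x}) \<in> \<B>" "insert x (D1 - {y}) \<in> \<B>"
        "f (insert y (C - {x})) + f (insert x (D1 - {y})) \<le> f C + f D1"
        by (auto simp: exchange_pair_def)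
      define D2 where "D2 = insert x (D1 - {y})"
      have yD: "y \<in> D - C" "y \<noteq> v" using y(1) u by (auto simp: D1_def)
      \<comment> \<open>Neutrality gives \<open>f (insert y (C - {x})) = f C\<close>, which cancels
        from the exchange inequality between \<open>C\<close> and \<open>D1\<close>.\<close>
      have D2: "D2 \<in> \<B>" "f D2 \<le> f D1"
        using y tight[OF yD(1) y(2)] by (auto simp: D2_def)
      have D2D: "D2 - D = {x, u}" and DD2: "D - D2 = {v, y}"
        using u v yD less.prems by (auto simp: D2_def D1_def V_def)
      have "card (D2 - D) = 2" using u D2D by simp
      then have "exchange_pair \<B> \<omega> D2 D x" using loc[OF D2(1) less.prems(1)] D2D by simp
      then have "exchange_pair \<B> f D2 D x"
        unfolding f_def using exchange_pair_tilt[of D2 D x] fin[OF D2(1)] finD D2D by blast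
      then obtain z where z: "z \<in> {v, y}" "insert z (D2 - {x}) \<in> \<B>" "insert x (D - {z}) \<in> \<B>"
        "f (insert z (D2 - {x})) + f (insert x (D - {z})) \<le> f D2 + f D"
        by (auto simp: exchange_pair_def DD2)
      \<comment> \<open>Returning \<open>x\<close> from \<open>D2\<close> for one element of
        \<open>{v, y}\<close> leaves a neighbour of \<open>D\<close> that contains \<open>u\<close>
        and lacks the other element. It therefore competes with \<open>D1\<close>, whose choice
        bounds its value from below.\<close>
      obtain z' where z': "z' \<in> {v, y}" "insert z (D2 - {x}) = insert u (D - {z'})"
      proof (cases "z = v")
        case True
        then have "insert z (D2 - {x}) = insert u (D - {y})"
          using u v yD less.prems by (auto simp: D2_def D1_def V_def)
        then show ?thesis using that by blast
      next
        case False
        then have "insert z (D2 - {x}) = insert u (D - {v})"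
          using z u v yD less.prems by (auto simp: D2_def D1_def V_def)
        then show ?thesis using that by blast
      qed
      have "z' \<in> V" using z' z v yD by (auto simp: V_def)
      then have "f D1 \<le> f (insert z (D2 - {x}))" using vmin z' by (simp add: D1_def)
      moreover have "f D < f (insert x (D - {z}))" using large[of z] z v yD by (auto simp: V_def)
      ultimately have "f D1 + f D < f D2 + f D"
        using z(4) by (meson add_le_less_mono less_le_trans)
      with D2 show False by simp
    qed
  qed
qed

section \<open>Minimizers of tilted valuations\<close>

definition minimizers ::
    "'e set set \<Rightarrow> ('e set \<Rightarrow> 'g::linordered_ab_group_add) \<Rightarrow> ('e \<Rightarrow> 'g) \<Rightarrow> 'e set set" where
  "minimizers \<B> \<omega> u = {B \<in> \<B>. \<forall>C \<in> \<B>. \<omega> B - sum u B \<le> \<omega> C - sum u C}"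

text \<open>Between two minimizers the tilted exchange inequality has twice the minimum on its right
  side, so the exchanged sets are again minimizers.\<close>

lemma matroid_minimizers:
  fixes \<omega> :: "'e set \<Rightarrow> 'g::linordered_ab_group_add"
  assumes mat: "matroid_bases E \<B>" and unif: "\<B> \<subseteq> [E]\<^bsup>r\<^esup>"
    and loc: "\<And>C D x. \<lbrakk>C \<in> \<B>; D \<in> \<B>; card (C - D) = 2; x \<in> C - D\<rbrakk> \<Longrightarrow> exchange_pair \<B> \<omega> C D x"
  shows "matroid_bases E (minimizers \<B> \<omega> u)"
proof (cases "\<exists>\<epsilon>::'g. 0 < \<epsilon>")
  case False
  \<comment> \<open>Without a positive element the group is trivial and every member of the support
    is a minimizer.\<close>
  then have "a \<le> b" for a b :: 'g by (metis diff_gt_0_iff_gt not_le)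
  then have "minimizers \<B> \<omega> u = \<B>" by (auto simp: minimizers_def)
  then show ?thesis using mat by simp
next
  case True
  define f where "f = (\<lambda>B. \<omega> B + sum (\<lambda>e. - u e) B)"
  have mini: "minimizers \<B> \<omega> u = {B \<in> \<B>. \<forall>C \<in> \<B>. f B \<le> f C}"
    by (simp add: minimizers_def f_def sum_negf)
  have fin: "finite \<B>" "\<B> \<noteq> {}" and sub: "\<B> \<subseteq> Pow E" "finite E"
    using mat by (auto simp: matroid_bases_def intro: finite_subset)
  have ne: "minimizers \<B> \<omega> u \<noteq> {}"
    unfolding mini using arg_min_if_finite[OF fin, of f] by (auto simp: not_less)
  have "\<exists>y \<in> D - C. insert y (C - {x}) \<in> minimizers \<B> \<omega> u"
    if "C \<in> minimizers \<B> \<omega> u" "D \<in> minimizers \<B> \<omega> u" "x \<in> C - D" for C D x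
  proof -
    have CD: "C \<in> \<B>" "D \<in> \<B>" and le: "\<And>B. B \<in> \<B> \<Longrightarrow> f C \<le> f B" "\<And>B. B \<in> \<B> \<Longrightarrow> f D \<le> f B"
      using that by (auto simp: mini)
    have "exchange_pair \<B> \<omega> C D x"
      using True local_exchange_imp_exchange[OF mat unif _ loc CD that(3)] by blast
    then have "exchange_pair \<B> f C D x"
      unfolding f_def using CD sub that(3) by (subst exchange_pair_tilt) (auto intro: finite_subset)
    then obtain y where y: "y \<in> D - C" "insert y (C - {x}) \<in> \<B>" "insert x (D - {y}) \<in> \<B>"
        "f (insert y (C - {x})) + f (insert x (D - {y})) \<le> f C + f D"
      by (auto simp: exchange_pair_def)
    have "f (insert y (C - {x})) \<le> f C"
      using y(4) le(2)[OF y(3)] by (meson add_less_le_mono not_le)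
    then have "insert y (C - {x}) \<in> minimizers \<B> \<omega> u"
      unfolding mini using y le(1) by (blast intro: order_trans)
    then show ?thesis using y by blast
  qed
  then show ?thesis using sub ne by (auto simp: matroid_bases_def minimizers_def)
qed

section \<open>Large weights as priorities\<close>

lemma sum_const_card_eq:
  fixes K :: "'g::comm_monoid_add"
  assumes "finite X" "finite Y" "card X = card Y"
  shows "sum (\<lambda>_. K) X = sum (\<lambda>_. K) Y"
proof -
  obtain h where "bij_betw h X Y" using assms finite_same_card_bij by blast
  then show ?thesis by (rule sum.reindex_bij_betw)
qed

lemma sum_const_card_less:
  fixes K :: "'g::linordered_ab_group_add"
  assumes "finite X" "finite Y" "card X < card Y" "0 \<le> K"
  shows "sum (\<lambda>_. K) X + K \<le> sum (\<lambda>_. K) Y"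
proof -
  obtain Z where Z: "Z \<subseteq> Y" "card Z = Suc (card X)"
    using assms by (meson Suc_leI obtain_subset_with_card_n)
  then obtain z W where W: "Z = insert z W" "z \<notin> W" "card W = card X"
    by (auto simp: card_Suc_eq)
  have "finite Z" using Z assms finite_subset by blast
  then have "sum (\<lambda>_. K) X + K = sum (\<lambda>_. K) Z"
    using W assms sum_const_card_eq[of X W K] by (simp add: add.commute)
  also have "\<dots> \<le> sum (\<lambda>_. K) Y" using assms Z by (intro sum_mono2) auto
  finally show ?thesis .
qed

text \<open>Adding a large constant on \<open>A\<close> gives priority to meeting \<open>A\<close>
  in many elements and leaves ties to the old weight \<open>u\<close>. Iterating this confines a
  minimization to an interval of subsets. Weak inequalities suffice, because the chosen sets only
  have to be minimizers, not the only ones.\<close>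

lemma heavy_weight:
  fixes \<omega> :: "'e set \<Rightarrow> 'g::linordered_ab_group_add"
  assumes "finite \<B>" "\<And>B. B \<in> \<B> \<Longrightarrow> finite B"
  obtains u' where
    "\<And>C D. \<lbrakk>C \<in> \<B>; D \<in> \<B>; card (D \<inter> A) < card (C \<inter> A)\<rbrakk> \<Longrightarrow>
       \<omega> C - sum u' C \<le> \<omega> D - sum u' D"
    "\<And>C D. \<lbrakk>C \<in> \<B>; D \<in> \<B>; card (D \<inter> A) = card (C \<inter> A); \<omega> C - sum u C \<le> \<omega> D - sum u D\<rbrakk> \<Longrightarrow>
       \<omega> C - sum u' C \<le> \<omega> D - sum u' D"
proof -
  define f where "f B = \<omega> B - sum u B" for B
  \<comment> \<open>\<open>K\<close> dominates every difference of tilted values, so one extra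
    element of \<open>A\<close> outweighs them all; including 0 makes \<open>K\<close>
    nonnegative.\<close>
  define K where "K = Max (insert 0 ((\<lambda>(C, D). f C - f D) ` (\<B> \<times> \<B>)))"
  have fin: "finite (insert 0 ((\<lambda>(C, D). f C - f D) ` (\<B> \<times> \<B>)))" using assms by simp
  have K0: "0 \<le> K" unfolding K_def using fin by (rule Max_ge) simp
  have K: "f C - f D \<le> K" if "C \<in> \<B>" "D \<in> \<B>" for C D
    unfolding K_def using fin by (rule Max_ge) (use that in auto)
  define u' where "u' e = u e + (if e \<in> A then K else 0)" for e
  have eq: "\<omega> B - sum u' B = f B - sum (\<lambda>_. K) (B \<inter> A)" if "B \<in> \<B>" for B
    using assms(2)[OF that] by (simp add: u'_def f_def sum.distrib sum.inter_restrict)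
  show ?thesis
  proof (rule that[of u'])
    fix C D assume CD: "C \<in> \<B>" "D \<in> \<B>"
    { assume "card (D \<inter> A) < card (C \<inter> A)"
      then have "sum (\<lambda>_. K) (D \<inter> A) + K \<le> sum (\<lambda>_. K) (C \<inter> A)"
        using assms CD K0 by (intro sum_const_card_less) auto
      then have "sum (\<lambda>_. K) (D \<inter> A) + (f C - f D) \<le> sum (\<lambda>_. K) (C \<inter> A)"
        using K[OF CD] by (meson add_left_mono order_trans)
      then show "\<omega> C - sum u' C \<le> \<omega> D - sum u' D"
        using CD by (simp add: eq algebra_simps) }
    { assume "card (D \<inter> A) = card (C \<inter> A)" "\<omega> C - sum u C \<le> \<omega> D - sum u D"
      then show "\<omega> C - sum u' C \<le> \<omega> D - sum u' D"
        using CD assms sum_const_card_eq[of "D \<inter> A" "C \<inter> A" K] by (simp add: eq f_def) }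
  qed
qed

text \<open>For given \<open>B\<close>, \<open>B'\<close> and \<open>x\<close>, a weight is built
  for which \<open>B\<close> and some basis \<open>C\<close> inside \<open>B \<union> B'\<close>
  avoiding \<open>x\<close> are minimizers together. Exchange among the minimizers then gives the
  required exchange in the support.\<close>

lemma matroid_if_minimizers:
  fixes \<omega> :: "'e set \<Rightarrow> 'g::linordered_ab_group_add"
  assumes E: "finite E" and unif: "\<B> \<subseteq> [E]\<^bsup>r\<^esup>" and mat: "\<And>u. matroid_bases E (minimizers \<B> \<omega> u)"
  shows "matroid_bases E \<B>"
proof -
  have finB: "finite B" and cardB: "card B = r" and BE: "B \<subseteq> E" if "B \<in> \<B>" for B
    using that unif by (auto simp: nsets_def)
  have fin: "finite \<B>" using E BE by (meson Pow_iff finite_Pow_iff finite_subset subsetI)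
  have "\<B> \<noteq> {}" using mat[of "\<lambda>_. 0"] by (auto simp: matroid_bases_def minimizers_def)
  moreover have "\<exists>y \<in> B' - B. insert y (B - {x}) \<in> \<B>"
    if B: "B \<in> \<B>" "B' \<in> \<B>" "x \<in> B - B'" for B B' x
  proof -
    \<comment> \<open>Under \<open>u2\<close>, lying inside \<open>B \<union> B'\<close> has
      priority, and ties are settled by \<open>u1\<close>, which favours meeting
      \<open>B - {x}\<close>. A basis containing \<open>x\<close> and all of \<open>B - {x}\<close>
      is \<open>B\<close>, so \<open>B\<close> is best among the bases containing
      \<open>x\<close>.\<close>
    obtain u1 where u1: "\<And>C D. \<lbrakk>C \<in> \<B>; D \<in> \<B>; card (D \<inter> (B - {x})) < card (C \<inter> (B - {x}))\<rbrakk> \<Longrightarrow>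
       \<omega> C - sum u1 C \<le> \<omega> D - sum u1 D"
      using heavy_weight[OF fin finB, where \<omega> = \<omega>] by metis
    obtain u2 where u2: "\<And>C D. \<lbrakk>C \<in> \<B>; D \<in> \<B>; card (D \<inter> (B \<union> B')) < card (C \<inter> (B \<union> B'))\<rbrakk> \<Longrightarrow>
       \<omega> C - sum u2 C \<le> \<omega> D - sum u2 D"
      "\<And>C D. \<lbrakk>C \<in> \<B>; D \<in> \<B>; card (D \<inter> (B \<union> B')) = card (C \<inter> (B \<union> B')); \<omega> C - sum u1 C \<le> \<omega> D - sum u1 D\<rbrakk> \<Longrightarrow>
       \<omega> C - sum u2 C \<le> \<omega> D - sum u2 D"
      using heavy_weight[OF fin finB, where u = u1 and \<omega> = \<omega>] by metis
    define g where "g C = \<omega> C - sum u2 C" for C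
    have outside: "g C \<le> g D" if "C \<in> \<B>" "D \<in> \<B>" "C \<subseteq> B \<union> B'" "\<not> D \<subseteq> B \<union> B'" for C D
    proof -
      have "D \<inter> (B \<union> B') \<subset> D" using that by blast
      then have "card (D \<inter> (B \<union> B')) < card D" using finB that by (meson psubset_card_mono)
      moreover have "C \<inter> (B \<union> B') = C" using that by blast
      ultimately show ?thesis unfolding g_def using that cardB by (intro u2(1)) auto
    qed
    have with_x: "g B \<le> g D" if D: "D \<in> \<B>" "x \<in> D" for D
    proof (cases "D = B \<or> \<not> D \<subseteq> B \<union> B'")
      case True
      then show ?thesis using outside[OF B(1) D(1)] by auto
    next
      case False
      then have "D \<inter> (B \<union> B') = D" "B \<inter> (B \<union> B') = B" by auto
      moreover have "\<omega> B - sum u1 B \<le> \<omega> D - sum u1 D"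
      proof (rule u1[OF B(1) D(1)])
        have "\<not> B - {x} \<subseteq> D"
        proof
          assume "B - {x} \<subseteq> D"
          then have "B \<subseteq> D" using D by blast
          then show False using False cardB[OF D(1)] cardB[OF B(1)] finB[OF D(1)] card_subset_eq by metis
        qed
        then have "D \<inter> (B - {x}) \<subset> B \<inter> (B - {x})" by blast
        then show "card (D \<inter> (B - {x})) < card (B \<inter> (B - {x}))"
          using finB[OF B(1)] by (intro psubset_card_mono) auto
      qed
      ultimately show ?thesis unfolding g_def using B D cardB by (intro u2(2)) auto
    qed
    define Q where "Q = {C \<in> \<B>. x \<notin> C \<and> C \<subseteq> B \<union> B'}"
    \<comment> \<open>\<open>B'\<close> itself belongs to \<open>Q\<close>.\<close>
    have "finite Q" "Q \<noteq> {}" using fin B by (auto simp: Q_def)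
    then obtain C where C: "C \<in> Q" and Cmin: "\<And>D. D \<in> Q \<Longrightarrow> g C \<le> g D"
      using arg_min_if_finite[of Q g] by (meson not_le)
    txt \<open>\<open>B\<close> is best among the bases containing \<open>x\<close> and \<open>C\<close> among those avoiding \<open>x\<close>, so adjusting the
      weight of \<open>x\<close> makes both minimal at once.\<close>
    define t where "t = g B - g C"
    define u where "u = u2(x := u2 x + t)"
    have eq: "\<omega> D - sum u D = g D - (if x \<in> D then t else 0)" if "D \<in> \<B>" for D
    proof -
      have "sum u D = sum (\<lambda>e. u2 e + (if e = x then t else 0)) D" by (intro sum.cong) (auto simp: u_def)
      then show ?thesis using finB[OF that] by (simp add: sum.distrib g_def)
    qed
    have "g C \<le> \<omega> D - sum u D" if "D \<in> \<B>" for D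
    proof (cases "x \<in> D")
      case True
      then show ?thesis using with_x[OF that] by (simp add: eq[OF that] t_def algebra_simps)
    next
      case False
      then show ?thesis using Cmin[of D] outside[of C D] that C by (auto simp: Q_def eq)
    qed
    then have "B \<in> minimizers \<B> \<omega> u" "C \<in> minimizers \<B> \<omega> u"
      using B C eq[of B] eq[of C] by (auto simp: minimizers_def Q_def t_def)
    moreover have "x \<in> B - C" using C B by (auto simp: Q_def)
    \<comment> \<open>Since \<open>C\<close> lies inside \<open>B \<union> B'\<close>, an element of
      \<open>C - B\<close> belongs to \<open>B' - B\<close>.\<close>
    ultimately obtain y where "y \<in> C - B" "insert y (B - {x}) \<in> minimizers \<B> \<omega> u"
      using mat[of u] unfolding matroid_bases_def by blast
    then show ?thesis using C by (auto simp: Q_def minimizers_def)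
  qed
  ultimately show ?thesis using E BE unfolding matroid_bases_def by blast
qed

text \<open>The guards stand for membership in the support: if one fails, that value is infinite,
  its part is unconstrained, and the other part can be taken as the bound itself.\<close>

lemma split_bound:
  fixes m :: "'g::linordered_ab_group_add"
  assumes "b \<Longrightarrow> b' \<Longrightarrow> m \<le> x + x'"
  obtains y y' where "y + y' = m" "b \<Longrightarrow> y \<le> x" "b' \<Longrightarrow> y' \<le> x'"
proof (cases b)
  case True
  then show ?thesis using assms by (intro that[of x "m - x"]) (auto simp: algebra_simps)
next
  case False
  then show ?thesis by (intro that[of "m - x'" x']) auto
qed

text \<open>The hypotheses say that, among the three ways to split \<open>a, b, c, d\<close> into
  two pairs, \<open>ab|cd\<close> has the smallest value. Then an affine function of the weights
  lies below the valuation on the interval from \<open>S\<close> to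
  \<open>S \<union> {a, b, c, d}\<close> and touches it at \<open>ab\<close> and
  \<open>cd\<close>.\<close>

lemma minimizers_pair:
  fixes \<omega> :: "'e set \<Rightarrow> 'g::linordered_ab_group_add"
  assumes E: "finite E" and unif: "\<B> \<subseteq> [E]\<^bsup>r\<^esup>"
    and S: "finite S" "distinct [a, b, c, d]" "S \<inter> {a, b, c, d} = {}"
    and ab: "S \<union> {a, b} \<in> \<B>" and cd: "S \<union> {c, d} \<in> \<B>"
    and ac: "S \<union> {a, c} \<in> \<B> \<Longrightarrow> S \<union> {b, d} \<in> \<B> \<Longrightarrow>
      \<omega> (S \<union> {a, b}) + \<omega> (S \<union> {c, d}) \<le> \<omega> (S \<union> {a, c}) + \<omega> (S \<union> {b, d})"
    and ad: "S \<union> {a, d} \<in> \<B> \<Longrightarrow> S \<union> {b, c} \<in> \<B> \<Longrightarrow>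
      \<omega> (S \<union> {a, b}) + \<omega> (S \<union> {c, d}) \<le> \<omega> (S \<union> {a, d}) + \<omega> (S \<union> {b, c})"
  obtains u where "S \<union> {a, b} \<in> minimizers \<B> \<omega> u" "S \<union> {c, d} \<in> minimizers \<B> \<omega> u"
proof -
  have finB: "finite B" and cardB: "card B = r" and BE: "B \<subseteq> E" if "B \<in> \<B>" for B
    using that unif by (auto simp: nsets_def)
  have fin: "finite \<B>" using E BE by (meson Pow_iff finite_Pow_iff finite_subset subsetI)
  define m where "m = \<omega> (S \<union> {a, b}) + \<omega> (S \<union> {c, d})"
  \<comment> \<open>The values at the other pairs are replaced by lower bounds such that all three
    sums over complementary pairs equal \<open>m\<close>. This equality is what allows the six
    values to come from weights.\<close>
  obtain qac qbd where q1: "qac + qbd = m" "S \<union> {a, c} \<in> \<B> \<Longrightarrow> qac \<le> \<omega> (S \<union> {a, c})"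
    "S \<union> {b, d} \<in> \<B> \<Longrightarrow> qbd \<le> \<omega> (S \<union> {b, d})"
    using split_bound[OF ac, folded m_def] by metis
  obtain qad qbc where q2: "qad + qbc = m" "S \<union> {a, d} \<in> \<B> \<Longrightarrow> qad \<le> \<omega> (S \<union> {a, d})"
    "S \<union> {b, c} \<in> \<B> \<Longrightarrow> qbc \<le> \<omega> (S \<union> {b, c})"
    using split_bound[OF ad, folded m_def] by metis
  txt \<open>These weights solve \<open>u\<^sub>i + u\<^sub>j + w = q\<^sub>i\<^sub>j\<close> for all six pairs, with \<open>q\<close> the values of \<open>\<omega>\<close> at \<open>ab\<close>
    and \<open>cd\<close>; freeness of \<open>w\<close> avoids a division by two.\<close>
  define ua where "ua = qad - \<omega> (S \<union> {c, d})"
  define w where "w = qac - ua"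
  define u0 where "u0 = (\<lambda>_. 0)(a := ua, b := \<omega> (S \<union> {a, b}) - w - ua, d := \<omega> (S \<union> {c, d}) - w)"
  have u0S: "sum u0 S = 0" using S by (intro sum.neutral) (auto simp: u0_def)
  have sum2: "sum u0 (S \<union> {i, j}) = u0 i + u0 j" if "i \<in> {a, b, c, d}" "j \<in> {a, b, c, d}" "i \<noteq> j" for i j
    using S that by (subst sum.union_disjoint) (auto simp: u0S)
  have u0: "u0 a = ua" "u0 b = \<omega> (S \<union> {a, b}) - w - ua" "u0 c = 0" "u0 d = \<omega> (S \<union> {c, d}) - w"
    using S(2) by (auto simp: u0_def)
  have q: "qbd = m - qac" "qbc = m - qad" using q1(1) q2(1) by (auto simp: algebra_simps)
  have ne: "a \<noteq> b" "c \<noteq> d" "a \<noteq> c" "b \<noteq> d" "a \<noteq> d" "b \<noteq> c" using S(2) by auto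
  have s: "sum u0 (S \<union> {a, b}) = \<omega> (S \<union> {a, b}) - w" "sum u0 (S \<union> {c, d}) = \<omega> (S \<union> {c, d}) - w"
    "sum u0 (S \<union> {a, c}) = qac - w" "sum u0 (S \<union> {b, d}) = qbd - w"
    "sum u0 (S \<union> {a, d}) = qad - w" "sum u0 (S \<union> {b, c}) = qbc - w"
    by (simp_all only: sum2[OF _ _ ne(1)] sum2[OF _ _ ne(2)] sum2[OF _ _ ne(3)]
        sum2[OF _ _ ne(4)] sum2[OF _ _ ne(5)] sum2[OF _ _ ne(6)] insert_iff simp_thms u0 q)
      (simp_all add: ua_def w_def m_def algebra_simps)
  have small: "w \<le> \<omega> D - sum u0 D" if D: "D \<in> \<B>" "S \<subseteq> D" "D \<subseteq> S \<union> {a, b, c, d}" for D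
  proof -
    have "card (S \<union> {a, b}) = card D" using cardB ab D by metis
    moreover have "card (S \<union> {a, b}) = card S + 2" using S by (subst card_Un_disjoint) auto
    ultimately have "card (D - S) = 2" using S D by (simp add: card_Diff_subset)
    then obtain i j where ij: "D - S = {i, j}" "i \<noteq> j" by (auto simp: card_2_iff)
    then have D': "D = S \<union> {i, j}" and "i \<in> {a, b, c, d}" "j \<in> {a, b, c, d}" using D by blast+
    have "D \<in> {S \<union> {a, b}, S \<union> {c, d}, S \<union> {a, c}, S \<union> {b, d}, S \<union> {a, d}, S \<union> {b, c}}"
      using \<open>i \<in> _\<close> \<open>j \<in> _\<close> ij(2) unfolding D' by (elim insertE emptyE) (simp_all add: insert_commute)
    moreover have "X \<in> \<B> \<Longrightarrow> w \<le> \<omega> X - sum u0 X"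
      if "X \<in> {S \<union> {a, b}, S \<union> {c, d}, S \<union> {a, c}, S \<union> {b, d}, S \<union> {a, d}, S \<union> {b, c}}" for X
      using that q1(2,3) q2(2,3) by (elim insertE emptyE) (simp_all only: s, simp_all)
    ultimately show ?thesis using D(1) by blast
  qed
  \<comment> \<open>The weight added last has the highest priority: contain \<open>S\<close>, then
    stay inside \<open>S \<union> {a, b, c, d}\<close>, then compare by \<open>u0\<close>. Hence the
    members of the interval with value \<open>w\<close> are minimizers.\<close>
  obtain u1 where u1: "\<And>C D. \<lbrakk>C \<in> \<B>; D \<in> \<B>; card (D \<inter> (S \<union> {a, b, c, d})) < card (C \<inter> (S \<union> {a, b, c, d}))\<rbrakk> \<Longrightarrow>
       \<omega> C - sum u1 C \<le> \<omega> D - sum u1 D"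
      "\<And>C D. \<lbrakk>C \<in> \<B>; D \<in> \<B>; card (D \<inter> (S \<union> {a, b, c, d})) = card (C \<inter> (S \<union> {a, b, c, d})); \<omega> C - sum u0 C \<le> \<omega> D - sum u0 D\<rbrakk> \<Longrightarrow>
       \<omega> C - sum u1 C \<le> \<omega> D - sum u1 D"
    using heavy_weight[OF fin finB, where u = u0 and \<omega> = \<omega>] by metis
  obtain u2 where u2: "\<And>C D. \<lbrakk>C \<in> \<B>; D \<in> \<B>; card (D \<inter> S) < card (C \<inter> S)\<rbrakk> \<Longrightarrow>
       \<omega> C - sum u2 C \<le> \<omega> D - sum u2 D"
      "\<And>C D. \<lbrakk>C \<in> \<B>; D \<in> \<B>; card (D \<inter> S) = card (C \<inter> S); \<omega> C - sum u1 C \<le> \<omega> D - sum u1 D\<rbrakk> \<Longrightarrow>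
       \<omega> C - sum u2 C \<le> \<omega> D - sum u2 D"
    using heavy_weight[OF fin finB, where u = u1 and \<omega> = \<omega>] by metis
  have tight: "C \<in> minimizers \<B> \<omega> u2"
    if C: "C \<in> \<B>" "S \<subseteq> C" "C \<subseteq> S \<union> {a, b, c, d}" "\<omega> C - sum u0 C = w" for C
  proof -
    have "\<omega> C - sum u2 C \<le> \<omega> D - sum u2 D" if D: "D \<in> \<B>" for D
    proof (cases "S \<subseteq> D")
      case False
      then have "D \<inter> S \<subset> C \<inter> S" using C by blast
      then show ?thesis using C D finB by (intro u2(1) psubset_card_mono) auto
    next
      case SD: True
      have "\<omega> C - sum u1 C \<le> \<omega> D - sum u1 D"
      proof (cases "D \<subseteq> S \<union> {a, b, c, d}")
        case False
        then have "D \<inter> (S \<union> {a, b, c, d}) \<subset> D" by blast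
        then have "card (D \<inter> (S \<union> {a, b, c, d})) < card D" using finB D by (meson psubset_card_mono)
        moreover have "C \<inter> (S \<union> {a, b, c, d}) = C" using C by blast
        ultimately show ?thesis using C D cardB by (intro u1(1)) auto
      next
        case True
        then have "D \<inter> (S \<union> {a, b, c, d}) = D" "C \<inter> (S \<union> {a, b, c, d}) = C" using C by blast+
        then show ?thesis using C D cardB small[OF D SD True] by (intro u1(2)) auto
      qed
      moreover have "D \<inter> S = C \<inter> S" using C SD by blast
      ultimately show ?thesis using C D by (intro u2(2)) auto
    qed
    then show ?thesis using C by (simp add: minimizers_def)
  qed
  show ?thesis
    using that[of u2] tight[OF ab] tight[OF cd] s(1,2) by auto
qed


section \<open>Three-term relations\<close>

definition pluecker_term ::
    "('a, 'b) tract_scheme \<Rightarrow> ('e::linorder set \<Rightarrow> 'a option) \<Rightarrow> 'e set \<Rightarrow> 'e set \<Rightarrow> 'e \<Rightarrow> 'a option" where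
  "pluecker_term F P I J j =
     tract_mult F (Some (pluecker_sign F j I J)) (tract_mult F (P (insert j I)) (P (J - {j})))"

lemma weak_pluecker_vectors_iff:
  "P \<in> weak_pluecker_vectors F E r \<longleftrightarrow>
     P \<in> [E]\<^bsup>r\<^esup> \<rightarrow>\<^sub>E tract_elems F \<and> matroid_bases E (pluecker_support E r P) \<and>
     (\<forall>I \<in> [E]\<^bsup>(r - 1)\<^esup>. \<forall>J \<in> [E]\<^bsup>(r + 1)\<^esup>. card (J - I) = 3 \<longrightarrow>
        formal_sum (pluecker_term F P I J) (J - I) \<in> nullset F)"
proof -
  have "pluecker_term F P I J = (\<lambda>j. tract_mult F (Some (pluecker_sign F j I J))
      (tract_mult F (P (insert j I)) (P (J - {j}))))" for I J
    by (simp add: pluecker_term_def fun_eq_iff)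
  moreover have "\<exists>B \<in> [E]\<^bsup>r\<^esup>. P B \<noteq> None" if "matroid_bases E (pluecker_support E r P)"
    using that by (auto simp: matroid_bases_def pluecker_support_def)
  ultimately show ?thesis unfolding weak_pluecker_vectors_def by auto
qed

text \<open>The classes of an equivalence relation cover its domain, which reduces the theorem to
  Pluecker vectors.\<close>

lemma ex_weak_matroid_iff:
  assumes "tract F"
  shows "(\<exists>M \<in> weak_matroids F E r. P \<in> M) \<longleftrightarrow> P \<in> weak_pluecker_vectors F E r"
  using Union_quotient[OF equiv_pluecker_scaling[OF assms, of E r]] by (auto simp: weak_matroids_def)

section \<open>Formal sums and their minimal parts\<close>

lemma formal_sum_cong:
  assumes "finite I" "\<And>i. i \<in> I \<Longrightarrow> f i = g i"
  shows "formal_sum f I = formal_sum g I"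
proof -
  have "{i \<in> I. f i \<noteq> None} = {i \<in> I. g i \<noteq> None}" using assms by auto
  then show ?thesis
    unfolding formal_sum_def using assms by (simp only:) (auto intro!: image_mset_cong)
qed

lemma formal_sum_None:
  assumes "\<And>i. i \<in> I \<Longrightarrow> f i = None"
  shows "formal_sum f I = {#}"
proof -
  have "{i \<in> I. f i \<noteq> None} = {}" using assms by auto
  then show ?thesis unfolding formal_sum_def by (simp only:) simp
qed

lemma formal_sum_single:
  assumes "i \<in> I" "f i = Some x" "\<And>j. j \<in> I \<Longrightarrow> j \<noteq> i \<Longrightarrow> f j = None"
  shows "formal_sum f I = {#x#}"
proof -
  have "(j \<in> I \<and> f j \<noteq> None) = (j = i)" for j using assms by (cases "j = i") auto
  then have "{j \<in> I. f j \<noteq> None} = {i}" by blast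
  then show ?thesis unfolding formal_sum_def using assms(2) by (simp only:) simp
qed

lemma set_formal_sum:
  assumes "finite I"
  shows "set_mset (formal_sum f I) = {x. \<exists>i \<in> I. f i = Some x}"
proof -
  have "set_mset (formal_sum f I) = (\<lambda>i. the (f i)) ` {i \<in> I. f i \<noteq> None}"
    using assms by (simp add: formal_sum_def)
  also have "\<dots> = {x. \<exists>i \<in> I. f i = Some x}" by force
  finally show ?thesis .
qed

text \<open>Selecting the minimal terms by index makes the result comparable, term by term, with a
  relation of an initial function. The guard excludes zero terms from the comparison, as
  \<open>the None\<close> carries no valuation.\<close>

lemma min_part_formal_sum:
  fixes g :: "'i \<Rightarrow> ('a \<times> 'g::linorder) option"
  assumes "finite I"
  shows "min_part (formal_sum g I) =
    formal_sum (\<lambda>i. if \<forall>j \<in> I. g j \<noteq> None \<longrightarrow> snd (the (g i)) \<le> snd (the (g j))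
                   then angular (g i) else None) I" (is "_ = formal_sum ?h I")
proof -
  have "(\<forall>x \<in> set_mset (formal_sum g I). snd (the (g i)) \<le> snd x) \<longleftrightarrow>
      (\<forall>j \<in> I. g j \<noteq> None \<longrightarrow> snd (the (g i)) \<le> snd (the (g j)))" for i
    by (auto simp: set_formal_sum[OF assms]) blast
  then have "{i \<in> I. ?h i \<noteq> None} =
      {i \<in> {i \<in> I. g i \<noteq> None}. \<forall>x \<in> set_mset (formal_sum g I). snd (the (g i)) \<le> snd x}"
    by (auto simp: angular_def)
  then have "min_part (formal_sum g I) =
      image_mset (\<lambda>i. fst (the (g i))) (mset_set {i \<in> I. ?h i \<noteq> None})"
    using assms by (simp add: min_part_def formal_sum_def filter_mset_image_mset
        image_mset.compositionality comp_def)
  also have "\<dots> = formal_sum ?h I"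
    unfolding formal_sum_def
    using assms by (intro image_mset_cong) (auto simp: angular_def split: if_splits)
  finally show ?thesis .
qed

section \<open>Signs in a tract and in its tropical extension\<close>

context tract
begin

lemma single_not_null:
  assumes "a \<in> carrier F"
  shows "{#a#} \<notin> nullset F"
  using scale_null[of "inv a" "{#a#}"] assms one_not_null by auto

lemma neg_one_closed: "neg_one F \<in> carrier F"
  and neg_one_null: "{#\<one>, neg_one F#} \<in> nullset F"
  using theI'[OF ex1_neg_one] by (auto simp: neg_one_def)

lemma neg_one_tropical:
  "neg_one (tropical_extension F :: ('a \<times> 'g::linordered_ab_group_add) tract) = (neg_one F, 0)"
proof -
  let ?T = "tropical_extension F :: ('a \<times> 'g) tract"
  interpret T: tract ?T by (rule tract_tropical_extension) (rule tract_axioms)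
  have "(neg_one F, 0) \<in> carrier ?T \<and> {#\<one>\<^bsub>?T\<^esub>, (neg_one F, 0)#} \<in> nullset ?T"
    using neg_one_closed neg_one_null by (simp add: tropical_extension_def min_part_def)
  then show ?thesis unfolding neg_one_def[of ?T] by (rule the1_equality[OF T.ex1_neg_one])
qed

lemma pluecker_sign_closed: "pluecker_sign F j I J \<in> carrier F"
  by (simp add: pluecker_sign_def neg_one_closed)

text \<open>Signs have valuation 0, so they do not influence which terms of a relation are
  minimal.\<close>

lemma pluecker_sign_tropical:
  "pluecker_sign (tropical_extension F :: ('a \<times> 'g::linordered_ab_group_add) tract) j I J =
     (pluecker_sign F j I J, 0)"
proof -
  have "(a, 0) [^]\<^bsub>(tropical_extension F :: ('a \<times> 'g) tract)\<^esub> n = (a [^] n, 0)" for a and n :: nat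
    by (induction n) (simp_all add: nat_pow_def tropical_extension_def)
  then show ?thesis by (simp add: pluecker_sign_def neg_one_tropical)
qed

end

section \<open>Valuation, support and initial functions of a fixed function\<close>

locale tropical_function = tract F for F :: "('a, 'b) tract_scheme" (structure) +
  fixes E :: "'e::linorder set" and r :: nat
    and P :: "'e set \<Rightarrow> ('a \<times> 'g::linordered_ab_group_add) option"
  assumes finite_E: "finite E" and r_pos: "1 \<le> r"
    and P_elems: "P \<in> [E]\<^bsup>r\<^esup> \<rightarrow>\<^sub>E tract_elems (tropical_extension F :: ('a \<times> 'g) tract)"
begin

abbreviation T :: "('a \<times> 'g) tract" where "T \<equiv> tropical_extension F"

abbreviation \<B> :: "'e set set" where "\<B> \<equiv> pluecker_support E r P"

text \<open>Meaningful on the support only, where it is the absolute value as an element of the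
  group itself; this makes subtraction and cancellation available.\<close>

definition \<omega> :: "'e set \<Rightarrow> 'g" where "\<omega> B = snd (the (P B))"

lemma support_nsets: "\<B> \<subseteq> [E]\<^bsup>r\<^esup>"
  by (auto simp: pluecker_support_def)

lemma support_Some:
  assumes "B \<in> \<B>"
  obtains a where "a \<in> carrier F" "P B = Some (a, \<omega> B)"
proof -
  obtain x where x: "P B = Some x" using assms by (auto simp: pluecker_support_def)
  have "P B \<in> tract_elems T" using assms P_elems support_nsets by (auto simp: PiE_iff)
  then show ?thesis
    using x that[of "fst x"] by (cases x) (auto simp: tract_elems_def tropical_extension_def \<omega>_def)
qed

text \<open>On the support, comparisons with infinite values hold trivially, so only bases matter.
  Off the support the minimality test is immaterial, because the angular part is \<open>None\<close>
  in any case.\<close>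

lemma initial_function_eq:
  assumes "B \<in> [E]\<^bsup>r\<^esup>"
  shows "initial_function E r u P B = (if B \<in> minimizers \<B> \<omega> u then angular (P B) else None)"
proof (cases "B \<in> \<B>")
  case False
  then have "P B = None" using assms unfolding pluecker_support_def by blast
  then show ?thesis using assms by (simp add: initial_function_def angular_def)
next
  case True
  have abs: "trop_abs (P C) - Fin (sum u C) = (if C \<in> \<B> then Fin (\<omega> C - sum u C) else Pinf)"
    if "C \<in> [E]\<^bsup>r\<^esup>" for C
    using that by (auto simp: pluecker_support_def trop_abs_def \<omega>_def split: option.split)
  have "(\<forall>C \<in> [E]\<^bsup>r\<^esup>. trop_abs (P B) - Fin (sum u B) \<le> trop_abs (P C) - Fin (sum u C)) \<longleftrightarrow>
      B \<in> minimizers \<B> \<omega> u"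
    using True support_nsets assms by (auto simp: minimizers_def abs)
  then show ?thesis using assms by (simp add: initial_function_def)
qed

lemma support_initial_function:
  "pluecker_support E r (initial_function E r u P) = minimizers \<B> \<omega> u"
proof -
  have "initial_function E r u P B \<noteq> None \<longleftrightarrow> B \<in> minimizers \<B> \<omega> u" if "B \<in> [E]\<^bsup>r\<^esup>" for B
    unfolding initial_function_eq[OF that]
    by (auto simp: angular_def minimizers_def pluecker_support_def)
  moreover have "minimizers \<B> \<omega> u \<subseteq> [E]\<^bsup>r\<^esup>" using support_nsets by (auto simp: minimizers_def)
  ultimately show ?thesis unfolding pluecker_support_def[of E r "initial_function E r u P"] by blast
qed

lemma initial_function_elems: "initial_function E r u P \<in> [E]\<^bsup>r\<^esup> \<rightarrow>\<^sub>E tract_elems F"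
proof (rule PiE_I)
  fix B assume B: "B \<in> [E]\<^bsup>r\<^esup>"
  show "initial_function E r u P B \<in> tract_elems F"
  proof (cases "B \<in> minimizers \<B> \<omega> u")
    case True
    then have "B \<in> \<B>" by (simp add: minimizers_def)
    then obtain a where "a \<in> carrier F" "P B = Some (a, \<omega> B)" by (rule support_Some)
    then show ?thesis using B True by (simp add: initial_function_eq angular_def tract_elems_def)
  qed (use B in \<open>simp add: initial_function_eq tract_elems_def\<close>)
qed (simp add: initial_function_def)

lemma pluecker_term_Some:
  assumes "insert j I \<in> \<B>" "J - {j} \<in> \<B>"
  obtains a where "a \<in> carrier F"
    "pluecker_term T P I J j = Some (a, \<omega> (insert j I) + \<omega> (J - {j}))"
proof -
  obtain b c where "b \<in> carrier F" "P (insert j I) = Some (b, \<omega> (insert j I))"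
    "c \<in> carrier F" "P (J - {j}) = Some (c, \<omega> (J - {j}))"
    using support_Some assms by metis
  then show ?thesis
    using that[of "pluecker_sign F j I J \<otimes> (b \<otimes> c)"]
    by (simp add: pluecker_term_def pluecker_sign_tropical pluecker_sign_closed)
      (simp add: tropical_extension_def)
qed

lemma nsets_exchange:
  assumes "I \<in> [E]\<^bsup>(r - 1)\<^esup>" "J \<in> [E]\<^bsup>(r + 1)\<^esup>" "j \<in> J - I"
  shows "insert j I \<in> [E]\<^bsup>r\<^esup>" "J - {j} \<in> [E]\<^bsup>r\<^esup>"
  using assms r_pos by (auto simp: nsets_def)

lemma pluecker_term_None_iff:
  assumes "I \<in> [E]\<^bsup>(r - 1)\<^esup>" "J \<in> [E]\<^bsup>(r + 1)\<^esup>" "j \<in> J - I"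
  shows "pluecker_term T P I J j = None \<longleftrightarrow> insert j I \<notin> \<B> \<or> J - {j} \<notin> \<B>"
proof -
  have "pluecker_term T P I J j = None \<longleftrightarrow> P (insert j I) = None \<or> P (J - {j}) = None"
    by (cases "P (insert j I)"; cases "P (J - {j})") (simp_all add: pluecker_term_def)
  then show ?thesis using nsets_exchange[OF assms] by (auto simp: pluecker_support_def)
qed

text \<open>The valuation of the term at \<open>j\<close> is
  \<open>f (insert j I) + f (J - {j})\<close> plus a quantity independent of \<open>j\<close>. The
  term at \<open>k\<close> attains the least possible sum \<open>m + m\<close>, so a term is minimal
  exactly when both its factors have value \<open>m\<close>, that is, when both survive in the
  initial function.\<close>

lemma min_part_pluecker_sum:
  assumes I: "I \<in> [E]\<^bsup>(r - 1)\<^esup>" and J: "J \<in> [E]\<^bsup>(r + 1)\<^esup>" and k: "k \<in> J - I"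
    and mk: "insert k I \<in> minimizers \<B> \<omega> u" "J - {k} \<in> minimizers \<B> \<omega> u"
  shows "min_part (formal_sum (pluecker_term T P I J) (J - I)) =
    formal_sum (pluecker_term F (initial_function E r u P) I J) (J - I)"
proof -
  have fin: "finite I" "finite J" using I J by (auto simp: nsets_def)
  define f where "f B = \<omega> B - sum u B" for B
  have mini: "B \<in> minimizers \<B> \<omega> u \<longleftrightarrow> B \<in> \<B> \<and> (\<forall>C \<in> \<B>. f B \<le> f C)" for B
    by (simp add: minimizers_def f_def)
  define m where "m = f (insert k I)"
  have m: "m \<le> f B" if "B \<in> \<B>" for B using mk that by (simp add: mini m_def)
  have mk2: "f (J - {k}) = m" using mk by (auto simp: mini m_def intro: order_antisym)
  have mini_m: "B \<in> minimizers \<B> \<omega> u \<longleftrightarrow> f B = m" if "B \<in> \<B>" for B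
    using that m mk by (auto simp: mini m_def intro: order_antisym)
  have \<omega>_f: "\<omega> (insert j I) + \<omega> (J - {j}) = f (insert j I) + f (J - {j}) + (sum u I + sum u J)"
    if "j \<in> J - I" for j
    using that fin by (simp add: f_def sum_diff1 algebra_simps)
  have snd_term: "snd (the (pluecker_term T P I J j)) = f (insert j I) + f (J - {j}) + (sum u I + sum u J)"
    and supp: "insert j I \<in> \<B>" "J - {j} \<in> \<B>"
    if "j \<in> J - I" "pluecker_term T P I J j \<noteq> None" for j
  proof -
    show *: "insert j I \<in> \<B>" "J - {j} \<in> \<B>" using pluecker_term_None_iff[OF I J that(1)] that(2) by auto
    show "snd (the (pluecker_term T P I J j)) = f (insert j I) + f (J - {j}) + (sum u I + sum u J)"
      using pluecker_term_Some[OF *] \<omega>_f[OF that(1)] by (metis option.sel snd_conv)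
  qed
  have k_term: "pluecker_term T P I J k \<noteq> None"
    using pluecker_term_None_iff[OF I J k] mk by (auto simp: mini)
  have "(if \<forall>i \<in> J - I. pluecker_term T P I J i \<noteq> None \<longrightarrow>
        snd (the (pluecker_term T P I J j)) \<le> snd (the (pluecker_term T P I J i))
      then angular (pluecker_term T P I J j) else None) =
      pluecker_term F (initial_function E r u P) I J j" (is "(if ?min then _ else _) = _")
    if j: "j \<in> J - I" for j
  proof (cases "pluecker_term T P I J j = None")
    case True
    then have "insert j I \<notin> minimizers \<B> \<omega> u \<or> J - {j} \<notin> minimizers \<B> \<omega> u"
      using pluecker_term_None_iff[OF I J j] by (auto simp: mini)
    then have "pluecker_term F (initial_function E r u P) I J j = None"
      unfolding pluecker_term_def initial_function_eq[OF nsets_exchange(1)[OF I J j]]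
        initial_function_eq[OF nsets_exchange(2)[OF I J j]]
      by (cases "angular (P (insert j I))") auto
    then show ?thesis using True by (simp add: angular_def)
  next
    case False
    note sj = supp[OF j False]
    obtain b c where bc: "P (insert j I) = Some (b, \<omega> (insert j I))" "P (J - {j}) = Some (c, \<omega> (J - {j}))"
      using support_Some sj by metis
    have "?min \<longleftrightarrow> f (insert j I) + f (J - {j}) \<le> m + m"
    proof
      assume ?min
      then show "f (insert j I) + f (J - {j}) \<le> m + m"
        unfolding snd_term[OF j False] using k k_term mk2 snd_term[OF k k_term]
        by (metis add_le_cancel_right m_def)
    next
      assume le: "f (insert j I) + f (J - {j}) \<le> m + m"
      show ?min
      proof (intro ballI impI)
        fix i assume i: "i \<in> J - I" "pluecker_term T P I J i \<noteq> None"
        have "m + m \<le> f (insert i I) + f (J - {i})"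
          by (intro add_mono m supp i)
        then show "snd (the (pluecker_term T P I J j)) \<le> snd (the (pluecker_term T P I J i))"
          using le by (auto simp: snd_term[OF j False] snd_term[OF i])
      qed
    qed
    also have "\<dots> \<longleftrightarrow> f (insert j I) = m \<and> f (J - {j}) = m"
      using m[OF sj(1)] m[OF sj(2)]
      by (metis add_le_less_mono add_less_le_mono le_less not_le order_refl)
    finally have min_iff: "?min \<longleftrightarrow> insert j I \<in> minimizers \<B> \<omega> u \<and> J - {j} \<in> minimizers \<B> \<omega> u"
      using mini_m sj by simp
    show ?thesis
      unfolding min_iff
      unfolding pluecker_term_def initial_function_eq[OF nsets_exchange(1)[OF I J j]]
        initial_function_eq[OF nsets_exchange(2)[OF I J j]]
      by (auto simp: bc angular_def pluecker_sign_tropical) (simp_all add: tropical_extension_def)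
  qed
  then show ?thesis
    using fin by (subst min_part_formal_sum) (auto intro!: formal_sum_cong)
qed

section \<open>The two implications\<close>

lemma nullset_tropical: "A \<in> nullset T \<longleftrightarrow> set_mset A \<subseteq> carrier F \<times> UNIV \<and> (A = {#} \<or> min_part A \<in> nullset F)"
  by (simp add: tropical_extension_def)

text \<open>A three-term relation is chosen in which one term has valuation
  \<open>\<omega> C + \<omega> D\<close> and the other two are the possible exchanges of
  \<open>x\<close>. If both exchanges fail, the minimal part is a single element, which is never
  null.\<close>

lemma local_exchange_if_weak_pluecker:
  assumes P: "P \<in> weak_pluecker_vectors T E r"
    and C: "C \<in> \<B>" and D: "D \<in> \<B>" and card: "card (C - D) = 2" and x: "x \<in> C - D"
  shows "exchange_pair \<B> \<omega> C D x"
proof (rule ccontr)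
  assume neg: "\<not> exchange_pair \<B> \<omega> C D x"
  have nC: "finite C" "card C = r" "C \<subseteq> E" and nD: "finite D" "card D = r" "D \<subseteq> E"
    using C D support_nsets by (auto simp: nsets_def)
  obtain b where b: "C - D = {x, b}" "b \<noteq> x"
    using card x by (metis card_2_iff doubleton_eq_iff insertE singletonD)
  have "card (D - C) = 2" using card nC nD by (metis card_le_sym_Diff le_antisym order_refl)
  then obtain c d where cd: "D - C = {c, d}" "c \<noteq> d" by (auto simp: card_2_iff)
  define I where "I = C - {b}"
  define J where "J = insert b D"
  have I: "I \<in> [E]\<^bsup>(r - 1)\<^esup>" and J: "J \<in> [E]\<^bsup>(r + 1)\<^esup>"
    using nC nD b by (auto simp: I_def J_def nsets_def)
  have JI: "J - I = {b, c, d}" using b cd by (auto simp: I_def J_def)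
  have "b \<notin> {c, d}" using b cd by blast
  then have "card (J - I) = 3" using cd JI by simp
  then have null: "formal_sum (pluecker_term T P I J) (J - I) \<in> nullset T"
    using P I J by (simp add: weak_pluecker_vectors_iff)
  have sets_b: "insert b I = C" "J - {b} = D" using b by (auto simp: I_def J_def)
  obtain a where a: "a \<in> carrier F" "pluecker_term T P I J b = Some (a, \<omega> C + \<omega> D)"
    using pluecker_term_Some[of b I J] C D by (auto simp: sets_b)
  have larger: "\<omega> C + \<omega> D < snd (the (pluecker_term T P I J j))"
    if j: "j \<in> J - I" "j \<noteq> b" "pluecker_term T P I J j \<noteq> None" for j
  proof -
    \<comment> \<open>The indices are crossed: the term at \<open>c\<close> is the exchange of
      \<open>x\<close> with \<open>d\<close>, and the term at \<open>d\<close> the one with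
      \<open>c\<close>.\<close>
    obtain y where y: "y \<in> D - C" "insert j I = insert x (D - {y})" "J - {j} = insert y (C - {x})"
    proof (cases "j = c")
      case True
      show ?thesis by (rule that[of d]) (use True b cd in \<open>auto simp: I_def J_def\<close>)
    next
      case False
      then have "j = d" using j JI by blast
      show ?thesis by (rule that[of c]) (use \<open>j = d\<close> b cd in \<open>auto simp: I_def J_def\<close>)
    qed
    have supp: "insert j I \<in> \<B>" "J - {j} \<in> \<B>"
      using pluecker_term_None_iff[OF I J j(1)] j(3) by auto
    then obtain a' where "pluecker_term T P I J j = Some (a', \<omega> (insert j I) + \<omega> (J - {j}))"
      by (rule pluecker_term_Some)
    moreover have "\<omega> C + \<omega> D < \<omega> (insert j I) + \<omega> (J - {j})"
      using neg y supp by (auto simp: exchange_pair_def not_le add.commute)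
    ultimately show ?thesis by simp
  qed
  have bJI: "b \<in> J - I" and fin: "finite (J - I)" using JI by auto
  have "min_part (formal_sum (pluecker_term T P I J) (J - I)) = {#a#}"
    unfolding min_part_formal_sum[OF fin]
  proof (rule formal_sum_single[OF bJI], goal_cases)
    case 1
    have "\<omega> C + \<omega> D \<le> snd (the (pluecker_term T P I J j))"
      if "j \<in> J - I" "pluecker_term T P I J j \<noteq> None" for j
      using larger[OF that(1) _ that(2)] a by (cases "j = b") (auto intro: less_imp_le)
    then show ?case using a by (auto simp: angular_def)
  next
    case (2 j)
    then show ?case
      using larger[of j] a bJI
      by (cases "pluecker_term T P I J j") (auto simp: angular_def not_le intro!: bexI[of _ b])
  qed
  moreover have "formal_sum (pluecker_term T P I J) (J - I) \<noteq> {#}"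
    using set_formal_sum[OF fin, of "pluecker_term T P I J"] a bJI by auto
  ultimately show False
    using null single_not_null[OF a(1)] by (simp add: nullset_tropical)
qed

lemma weak_pluecker_initial_function:
  assumes P: "P \<in> weak_pluecker_vectors T E r"
  shows "initial_function E r u P \<in> weak_pluecker_vectors F E r"
  unfolding weak_pluecker_vectors_iff support_initial_function
proof (intro conjI ballI impI initial_function_elems)
  show "matroid_bases E (minimizers \<B> \<omega> u)"
    using P by (intro matroid_minimizers[OF _ support_nsets] local_exchange_if_weak_pluecker)
      (auto simp: weak_pluecker_vectors_iff)
  fix I J :: "'e set"
  assume I: "I \<in> [E]\<^bsup>(r - 1)\<^esup>" and J: "J \<in> [E]\<^bsup>(r + 1)\<^esup>" and card: "card (J - I) = 3"
  let ?Q = "initial_function E r u P"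
  have fin: "finite (J - I)" using J by (auto simp: nsets_def)
  show "formal_sum (pluecker_term F ?Q I J) (J - I) \<in> nullset F"
  proof (cases "\<exists>k \<in> J - I. insert k I \<in> minimizers \<B> \<omega> u \<and> J - {k} \<in> minimizers \<B> \<omega> u")
    case True
    then obtain k where k: "k \<in> J - I" "insert k I \<in> minimizers \<B> \<omega> u" "J - {k} \<in> minimizers \<B> \<omega> u"
      by blast
    then have "insert k I \<in> \<B>" "J - {k} \<in> \<B>" by (auto simp: minimizers_def)
    then have "pluecker_term T P I J k \<noteq> None" using pluecker_term_None_iff[OF I J k(1)] by simp
    then have "formal_sum (pluecker_term T P I J) (J - I) \<noteq> {#}"
      using set_formal_sum[OF fin, of "pluecker_term T P I J"] k(1) by auto
    moreover have "formal_sum (pluecker_term T P I J) (J - I) \<in> nullset T"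
      using P I J card by (simp add: weak_pluecker_vectors_iff)
    ultimately have "min_part (formal_sum (pluecker_term T P I J) (J - I)) \<in> nullset F"
      by (simp add: nullset_tropical)
    then show ?thesis by (simp add: min_part_pluecker_sum[OF I J k])
  next
    case False
    have "pluecker_term F ?Q I J j = None" if j: "j \<in> J - I" for j
      using False j unfolding pluecker_term_def initial_function_eq[OF nsets_exchange(1)[OF I J j]]
        initial_function_eq[OF nsets_exchange(2)[OF I J j]]
      by (cases "angular (P (insert j I))") auto
    then show ?thesis using zero_null by (subst formal_sum_None) auto
  qed
qed

text \<open>A relation with a nonzero term has a term \<open>b\<close> of least valuation, and some
  \<open>u\<close> makes both factors of that term minimizers. The relation for this initial
  function is then the minimal part of the given one.\<close>

lemma weak_pluecker_if_initial_functions: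
  assumes init: "\<And>u. initial_function E r u P \<in> weak_pluecker_vectors F E r"
  shows "P \<in> weak_pluecker_vectors T E r"
  unfolding weak_pluecker_vectors_iff
proof (intro conjI ballI impI P_elems)
  show "matroid_bases E \<B>"
    using init by (intro matroid_if_minimizers[OF finite_E support_nsets, of \<omega>])
      (simp add: weak_pluecker_vectors_iff support_initial_function)
  fix I J :: "'e set"
  assume I: "I \<in> [E]\<^bsup>(r - 1)\<^esup>" and J: "J \<in> [E]\<^bsup>(r + 1)\<^esup>" and card: "card (J - I) = 3"
  let ?t = "pluecker_term T P I J"
  have fin: "finite I" "finite J" "finite (J - I)" using I J by (auto simp: nsets_def)
  define K where "K = {j \<in> J - I. ?t j \<noteq> None}"
  have carrier: "set_mset (formal_sum ?t (J - I)) \<subseteq> carrier F \<times> UNIV"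
  proof -
    have "a \<in> carrier F" if "j \<in> J - I" "?t j = Some (a, \<gamma>)" for j a \<gamma>
      using pluecker_term_Some[of j I J] pluecker_term_None_iff[OF I J that(1)] that(2)
      by (metis option.distinct(1) option.inject prod.inject)
    then show ?thesis by (auto simp: set_formal_sum[OF fin(3)])
  qed
  show "formal_sum ?t (J - I) \<in> nullset T"
  proof (cases "K = {}")
    case True
    then have "formal_sum ?t (J - I) = {#}" by (intro formal_sum_None) (use K_def in blast)
    then show ?thesis by (simp add: nullset_tropical)
  next
    case False
    moreover have "finite K" using fin by (simp add: K_def)
    ultimately obtain b where b: "b \<in> K" and bmin: "\<And>j. j \<in> K \<Longrightarrow> snd (the (?t b)) \<le> snd (the (?t j))"
      using arg_min_if_finite[of K "\<lambda>j. snd (the (?t j))"] by (meson not_le)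
    have bJI: "b \<in> J - I" using b by (simp add: K_def)
    have "card (J - I - {b}) = 2" using card bJI fin by simp
    then obtain c d where cd: "J - I - {b} = {c, d}" "c \<noteq> d" by (auto simp: card_2_iff)
    \<comment> \<open>With \<open>card (J - I) = 3\<close> the count gives
      \<open>card (I - J) = 1\<close>; here \<open>r_pos\<close> makes \<open>r - 1\<close> a
      genuine subtraction. So \<open>I\<close> and \<open>J\<close> consist of a common part
      \<open>S\<close> with \<open>a\<close> added and with \<open>b, c, d\<close> added,
      respectively.\<close>
    have "card I + card (J - I) = card J + card (I - J)"
      using fin by (metis Un_commute add.commute card_Un_disjoint Diff_disjoint Un_Diff_cancel finite_Diff)
    then have "card (I - J) = 1" using I J card r_pos by (auto simp: nsets_def)
    then obtain a where a: "I - J = {a}" by (auto simp: card_1_singleton_iff)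
    define S where "S = I \<inter> J"
    have sets: "insert b I = S \<union> {a, b}" "J - {b} = S \<union> {c, d}" "insert c I = S \<union> {a, c}"
      "J - {c} = S \<union> {b, d}" "insert d I = S \<union> {a, d}" "J - {d} = S \<union> {b, c}"
      using a bJI cd by (auto simp: S_def)
    have S: "finite S" "distinct [a, b, c, d]" "S \<inter> {a, b, c, d} = {}"
      using fin a bJI cd by (auto simp: S_def)
    have weight: "snd (the (?t j)) = \<omega> (insert j I) + \<omega> (J - {j})"
      if "insert j I \<in> \<B>" "J - {j} \<in> \<B>" for j
      using pluecker_term_Some[OF that] by (metis option.sel snd_conv)
    have in_K: "j \<in> K \<longleftrightarrow> insert j I \<in> \<B> \<and> J - {j} \<in> \<B>" if "j \<in> J - I" for j
      using pluecker_term_None_iff[OF I J that] that by (auto simp: K_def)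
    have bB: "insert b I \<in> \<B>" "J - {b} \<in> \<B>" using in_K[OF bJI] b by auto
    have le: "\<omega> (insert b I) + \<omega> (J - {b}) \<le> \<omega> (insert j I) + \<omega> (J - {j})"
      if "j \<in> J - I" "insert j I \<in> \<B>" "J - {j} \<in> \<B>" for j
      using bmin[of j] in_K[OF that(1)] that weight bB by simp
    have JI: "c \<in> J - I" "d \<in> J - I" using cd by auto
    obtain u where u: "insert b I \<in> minimizers \<B> \<omega> u" "J - {b} \<in> minimizers \<B> \<omega> u"
      using minimizers_pair[OF finite_E support_nsets S bB[unfolded sets] le[OF JI(1), unfolded sets]
          le[OF JI(2), unfolded sets]] unfolding sets by blast
    have "min_part (formal_sum ?t (J - I)) \<in> nullset F"
      unfolding min_part_pluecker_sum[OF I J bJI u]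
      using init[of u] I J card by (simp add: weak_pluecker_vectors_iff)
    then show ?thesis using carrier by (simp add: nullset_tropical)
  qed
qed

end

theorem theorem3p6:
  fixes F :: "('a, 'b) tract_scheme"
    and E :: "'e::linorder set"
    and r :: nat
    and P :: "'e set \<Rightarrow> ('a \<times> 'g::linordered_ab_group_add) option"
  assumes "tract F"
    and "finite E"
    and "1 \<le> r" and "r \<le> card E"
    and "P \<in> [E]\<^bsup>r\<^esup> \<rightarrow>\<^sub>E tract_elems (tropical_extension F :: ('a \<times> 'g) tract)"
  shows "(\<exists>M \<in> weak_matroids (tropical_extension F :: ('a \<times> 'g) tract) E r. P \<in> M) \<longleftrightarrow>
         (\<forall>u :: 'e \<Rightarrow> 'g. \<exists>Mu \<in> weak_matroids F E r. initial_function E r u P \<in> Mu)"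
proof -
  interpret tropical_function F E r P
    using assms by (simp add: tropical_function_def tropical_function_axioms_def)
  show ?thesis
    unfolding ex_weak_matroid_iff[OF assms(1)] ex_weak_matroid_iff[OF tract_tropical_extension[OF assms(1)]]
    using weak_pluecker_initial_function weak_pluecker_if_initial_functions by blast
qed

end
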